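(* Let $(\Xi,\Theta,\Gamma)$ be a G-complete fuzzy metric space whose $t$-norm $\Gamma$ is of $\mathfrak{H}$-type and such that $\lim_{\rho\to\infty}\Theta(u,v,\rho)=1$ for all $u,v\in\Xi$. Let $\zeta\in\Pi$. If $f:\Xi\to\Xi$ is a $\zeta$-contraction mapping, then $f$ possesses a unique fixed point $z$; moreover, the sequence $\{f^n u\}$ converges to $z$ for each $u\in\Xi$.
   Context: $\mathbb{N}=\{0,1,2,\dots\}$. A $t$-norm is a binary operation $\Gamma:[0,1]\times[0,1]\to[0,1]$ that is commutative, associative, monotone ($\Gamma(\mu,\nu)\le\Gamma(\mu,w)$ whenever $\nu\le w$) and satisfies $\Gamma(\mu,1)=\Gamma(1,\mu)=\mu$ for all $\mu\in[0,1]$. For $\mu\in[0,1]$ put $\Gamma^0(\mu)=1$ and $\Gamma^n(\mu)=\Gamma(\Gamma^{n-1}(\mu),\mu)$ for $n\ge1$. The $t$-norm $\Gamma$ is of $\mathfrak{H}$-type if for every $\epsilon\in(0,1)$ there exists $\lambda\in(0,1)$ such that for $\rho\in[0,1]$, $\rho>1-\lambda$ implies $\Gamma^n(\rho)>1-\epsilon$ for all $n\ge1$. A fuzzy metric on a non-empty set $\Xi$ is a mapping $\Theta:\Xi\times\Xi\times(0,\infty)\to(0,1]$ such that for all $u,v\in\Xi$ and $\rho>0$: $\Theta(u,v,\rho)>0$; [$\Theta(u,v,\rho)=1$ if and only if $u=v$]; $\Theta(u,v,\rho)=\Theta(v,u,\rho)$. A fuzzy metric space (in the sense of George and Veeramani)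 is a triple $(\Xi,\Theta,\Gamma)$ where $\Xi$ is a non-empty set, $\Theta$ is a fuzzy metric on $\Xi$, $\Gamma$ is a continuous $t$-norm, and for all $u,v,z\in\Xi$ and $\rho,s>0$: $\Theta(u,z,\rho+s)\ge\Gamma(\Theta(u,v,\rho),\Theta(v,z,s))$, and $\Theta(u,v,\cdot):(0,\infty)\to(0,1]$ is continuous. A sequence $\{x_n\}$ in $\Xi$ converges to $x\in\Xi$ if for all $\epsilon\in(0,1)$ and $\rho>0$ there exists $N\in\mathbb{N}$ such that $\Theta(x_n,x,\rho)>1-\epsilon$ whenever $n\ge N$. It is G-Cauchy if for every positive integer $p$, all $\epsilon\in(0,1)$ and all $\rho>0$, there exists $N\in\mathbb{N}$ such that $\Theta(x_n,x_{n+p},\rho)>1-\epsilon$ whenever $n\ge N$ (here $N$ may depend on $p$, $\epsilon$ and $\rho$). The space $(\Xi,\Theta,\Gamma)$ is G-complete if every G-Cauchy sequence converges to some $x\in\Xi$. $\Pi$ denotes the set of all functions $\zeta:(0,\infty)\to(0,\infty)$ such that $\lim_{n\to\infty}\zeta^n(\rho)=0$ for all $\rho>0$, where $\zeta^n$ is the $n$-th iterate of $\zeta$. A mapping $f:\Xi\to\Xi$ is a $\zeta$-contraction (with $\zeta\in\Pi$) if $\Theta(fu,fv,\zeta(\rho))\ge\Theta(u,v,\rho)$ for all $u,v\in\Xi$ and $\rho>0$. A fixed point of $f$ is a point $z\in\Xi$ with $fz=z$, and $f^n$ denotes the $n$-th iterate of $f$. *)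

theory Defs
  imports "HOL-Analysis.Analysis"
begin

text \<open>
  All operations are total functions on the ambient types. Every axiom is relativised to the
  intended domain (the unit interval, the carrier set, or the positive reals), and the values
  outside that domain are irrelevant.
\<close>

locale t_norm =
  fixes T :: "real \<Rightarrow> real \<Rightarrow> real"
  assumes closed: "\<mu> \<in> {0..1} \<Longrightarrow> \<nu> \<in> {0..1} \<Longrightarrow> T \<mu> \<nu> \<in> {0..1}"
    and commute: "\<mu> \<in> {0..1} \<Longrightarrow> \<nu> \<in> {0..1} \<Longrightarrow> T \<mu> \<nu> = T \<nu> \<mu>"
    and assoc: "\<mu> \<in> {0..1} \<Longrightarrow> \<nu> \<in> {0..1} \<Longrightarrow> w \<in> {0..1} \<Longrightarrow> T (T \<mu> \<nu>) w = T \<mu> (T \<nu> w)"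
    and mono: "\<mu> \<in> {0..1} \<Longrightarrow> \<nu> \<in> {0..1} \<Longrightarrow> w \<in> {0..1} \<Longrightarrow> \<nu> \<le> w \<Longrightarrow> T \<mu> \<nu> \<le> T \<mu> w"
    and right_unit: "\<mu> \<in> {0..1} \<Longrightarrow> T \<mu> 1 = \<mu>"
    and left_unit: "\<mu> \<in> {0..1} \<Longrightarrow> T 1 \<mu> = \<mu>"

primrec t_norm_power :: "(real \<Rightarrow> real \<Rightarrow> real) \<Rightarrow> nat \<Rightarrow> real \<Rightarrow> real" where
  "t_norm_power T 0 \<mu> = 1"
| "t_norm_power T (Suc n) \<mu> = T (t_norm_power T n \<mu>) \<mu>"

definition H_type :: "(real \<Rightarrow> real \<Rightarrow> real) \<Rightarrow> bool" where
  "H_type T \<longleftrightarrow>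
    (\<forall>\<epsilon>\<in>{0<..<1}. \<exists>l\<in>{0<..<1}. \<forall>\<rho>\<in>{0..1}.
       \<rho> > 1 - l \<longrightarrow> (\<forall>n\<ge>1. t_norm_power T n \<rho> > 1 - \<epsilon>))"

locale fuzzy_metric =
  fixes X :: "'a set" and F :: "'a \<Rightarrow> 'a \<Rightarrow> real \<Rightarrow> real"
  assumes nonempty: "X \<noteq> {}"
    and range: "u \<in> X \<Longrightarrow> v \<in> X \<Longrightarrow> \<rho> > 0 \<Longrightarrow> F u v \<rho> \<in> {0<..1}"
    and eq_1_iff: "u \<in> X \<Longrightarrow> v \<in> X \<Longrightarrow> \<rho> > 0 \<Longrightarrow> F u v \<rho> = 1 \<longleftrightarrow> u = v"
    and sym: "u \<in> X \<Longrightarrow> v \<in> X \<Longrightarrow> \<rho> > 0 \<Longrightarrow> F u v \<rho> = F v u \<rho>"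

text \<open>Fuzzy metric spaces in the sense of George and Veeramani.\<close>

locale fuzzy_metric_space = fuzzy_metric X F + t_norm T
  for X :: "'a set" and F :: "'a \<Rightarrow> 'a \<Rightarrow> real \<Rightarrow> real" and T :: "real \<Rightarrow> real \<Rightarrow> real" +
  assumes t_norm_continuous: "continuous_on ({0..1} \<times> {0..1}) (\<lambda>(\<mu>, \<nu>). T \<mu> \<nu>)"
    and triangle: "u \<in> X \<Longrightarrow> v \<in> X \<Longrightarrow> z \<in> X \<Longrightarrow> \<rho> > 0 \<Longrightarrow> s > 0 \<Longrightarrow>
      F u z (\<rho> + s) \<ge> T (F u v \<rho>) (F v z s)"
    and continuous: "u \<in> X \<Longrightarrow> v \<in> X \<Longrightarrow> continuous_on {0<..} (F u v)"

definition fuzzy_converges :: "('a \<Rightarrow> 'a \<Rightarrow> real \<Rightarrow> real) \<Rightarrow> (nat \<Rightarrow> 'a) \<Rightarrow> 'a \<Rightarrow> bool" where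
  "fuzzy_converges F x l \<longleftrightarrow>
    (\<forall>\<epsilon>\<in>{0<..<1}. \<forall>\<rho>>0. \<exists>N. \<forall>n\<ge>N. F (x n) l \<rho> > 1 - \<epsilon>)"

definition G_Cauchy :: "('a \<Rightarrow> 'a \<Rightarrow> real \<Rightarrow> real) \<Rightarrow> (nat \<Rightarrow> 'a) \<Rightarrow> bool" where
  "G_Cauchy F x \<longleftrightarrow>
    (\<forall>p\<ge>1. \<forall>\<epsilon>\<in>{0<..<1}. \<forall>\<rho>>0. \<exists>N. \<forall>n\<ge>N. F (x n) (x (n + p)) \<rho> > 1 - \<epsilon>)"

definition G_complete :: "'a set \<Rightarrow> ('a \<Rightarrow> 'a \<Rightarrow> real \<Rightarrow> real) \<Rightarrow> bool" where
  "G_complete X F \<longleftrightarrow>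
    (\<forall>x. (\<forall>n. x n \<in> X) \<longrightarrow> G_Cauchy F x \<longrightarrow> (\<exists>l\<in>X. fuzzy_converges F x l))"

text \<open>The class \<open>\<Pi>\<close> of gauge functions on the positive reals whose iterates tend to 0.\<close>

definition gauge_functions :: "(real \<Rightarrow> real) set" where
  "gauge_functions =
    {\<zeta> \<in> {0<..} \<rightarrow> {0<..}. \<forall>\<rho>>0. (\<lambda>n. (\<zeta> ^^ n) \<rho>) \<longlonglongrightarrow> 0}"

definition zeta_contraction ::
    "'a set \<Rightarrow> ('a \<Rightarrow> 'a \<Rightarrow> real \<Rightarrow> real) \<Rightarrow> (real \<Rightarrow> real) \<Rightarrow> ('a \<Rightarrow> 'a) \<Rightarrow> bool" where
  "zeta_contraction X F \<zeta> f \<longleftrightarrow>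
    f \<in> X \<rightarrow> X \<and> (\<forall>u\<in>X. \<forall>v\<in>X. \<forall>\<rho>>0. F (f u) (f v) (\<zeta> \<rho>) \<ge> F u v \<rho>)"

end

theory Submission
  imports Defs
begin

text \<open>
  Write \<open>F u v \<rho>\<close> for the degree of nearness of \<open>u\<close> and \<open>v\<close> at scale \<open>\<rho>\<close>. It is nondecreasing in
  \<open>\<rho>\<close>, and iterating the contraction condition gives
  \<open>F (f\<^sup>n u) (f\<^sup>n v) (\<zeta>\<^sup>n \<rho>) \<ge> F u v \<rho>\<close>. Since \<open>F u v \<rho>\<close> tends to \<open>1\<close> as \<open>\<rho>\<close> grows, the
  right-hand side is as close to \<open>1\<close> as desired for a suitable \<open>\<rho>\<close>, and for that fixed \<open>\<rho>\<close> the
  scale \<open>\<zeta>\<^sup>n \<rho>\<close> eventually drops below any given \<open>t > 0\<close>. Hence any two orbits are asymptotic: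
  \<open>F (f\<^sup>n u) (f\<^sup>n v) t\<close> tends to \<open>1\<close> for every fixed scale \<open>t\<close> (lemma \<open>orbits_asymptotic\<close>).

  This fact carries the proof. For \<open>v = f\<^sup>p u\<close> it says that orbits are G-Cauchy, because the
  G-Cauchy condition treats each gap \<open>p\<close> separately; so an orbit has a limit \<open>z\<close> in a
  G-complete space. A \<open>\<zeta>\<close>-contraction preserves convergent sequences (lemma
  \<open>contraction_converges\<close>) and limits are unique (lemma \<open>limit_unique\<close>), so \<open>f z = z\<close>.
  Since the orbit of \<open>z\<close> is constant, the orbit of every point, being asymptotic to it, converges
  to \<open>z\<close>. The orbit of a fixed point \<open>w\<close> converges to \<open>w\<close> as well, which yields \<open>w = z\<close>.
\<close>

section \<open>Convergence in fuzzy metric spaces\<close>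

lemma tendsto_one_iff_of_le_one:
  fixes g :: "nat \<Rightarrow> real"
  assumes "\<And>n. g n \<le> 1"
  shows "g \<longlonglongrightarrow> 1 \<longleftrightarrow> (\<forall>\<epsilon>\<in>{0<..<1}. \<exists>N. \<forall>n\<ge>N. g n > 1 - \<epsilon>)"
proof
  assume "g \<longlonglongrightarrow> 1"
  then have "\<forall>\<^sub>F n in sequentially. 1 - \<epsilon> < g n" if "\<epsilon> > 0" for \<epsilon>
    by (rule order_tendstoD(1)) (use that in simp)
  then show "\<forall>\<epsilon>\<in>{0<..<1}. \<exists>N. \<forall>n\<ge>N. g n > 1 - \<epsilon>"
    by (simp add: eventually_sequentially)
next
  assume R: "\<forall>\<epsilon>\<in>{0<..<1}. \<exists>N. \<forall>n\<ge>N. g n > 1 - \<epsilon>"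
  show "g \<longlonglongrightarrow> 1"
  proof (rule order_tendstoI)
    fix a :: real assume "a < 1"
    \<comment> \<open>The bound \<open>1/2\<close> keeps the tolerance below \<open>1\<close> when \<open>a \<le> 0\<close>.\<close>
    then have "min (1 - a) (1/2) \<in> {0<..<1}" by auto
    with R obtain N where "\<forall>n\<ge>N. g n > 1 - min (1 - a) (1/2)" by blast
    then have "\<forall>n\<ge>N. a < g n" by (auto simp: min_def split: if_splits)
    then show "\<forall>\<^sub>F n in sequentially. a < g n" by (auto simp: eventually_sequentially)
  next
    fix a :: real assume "1 < a"
    then show "\<forall>\<^sub>F n in sequentially. g n < a"
      using le_less_trans[OF assms] by (intro always_eventually) blast
  qed
qed

context fuzzy_metric
begin

lemma fuzzy_converges_iff_tendsto:
  assumes "\<And>n. x n \<in> X" "l \<in> X"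
  shows "fuzzy_converges F x l \<longleftrightarrow> (\<forall>\<rho>>0. (\<lambda>n. F (x n) l \<rho>) \<longlonglongrightarrow> 1)"
proof -
  have "(\<lambda>n. F (x n) l \<rho>) \<longlonglongrightarrow> 1 \<longleftrightarrow> (\<forall>\<epsilon>\<in>{0<..<1}. \<exists>N. \<forall>n\<ge>N. F (x n) l \<rho> > 1 - \<epsilon>)"
    if "\<rho> > 0" for \<rho>
    using range[OF assms that] by (intro tendsto_one_iff_of_le_one) auto
  then show ?thesis unfolding fuzzy_converges_def by blast
qed

lemma G_Cauchy_iff_tendsto:
  assumes "\<And>n. x n \<in> X"
  shows "G_Cauchy F x \<longleftrightarrow> (\<forall>p\<ge>1. \<forall>\<rho>>0. (\<lambda>n. F (x n) (x (n + p)) \<rho>) \<longlonglongrightarrow> 1)"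
proof -
  have "(\<lambda>n. F (x n) (x (n + p)) \<rho>) \<longlonglongrightarrow> 1 \<longleftrightarrow>
      (\<forall>\<epsilon>\<in>{0<..<1}. \<exists>N. \<forall>n\<ge>N. F (x n) (x (n + p)) \<rho> > 1 - \<epsilon>)"
    if "\<rho> > 0" for \<rho> p
    using range[OF assms assms that] by (intro tendsto_one_iff_of_le_one) auto
  then show ?thesis unfolding G_Cauchy_def by blast
qed

end

context fuzzy_metric_space
begin

text \<open>This is the triangle inequality with a first step from \<open>u\<close> to itself, whose nearness \<open>1\<close> is the
  unit of the t-norm.\<close>

lemma fuzzy_metric_mono:
  assumes "u \<in> X" "v \<in> X" "0 < s" "s \<le> t"
  shows "F u v s \<le> F u v t"
proof (cases "s = t")
  case False
  with assms have pos: "t - s > 0" by simp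
  have "F u v s = T (F u u (t - s)) (F u v s)"
    using assms range[of u v s] eq_1_iff[OF \<open>u \<in> X\<close> \<open>u \<in> X\<close> pos] left_unit[of "F u v s"] by auto
  also have "\<dots> \<le> F u v t"
    using triangle[OF \<open>u \<in> X\<close> \<open>u \<in> X\<close> \<open>v \<in> X\<close> pos \<open>0 < s\<close>] by simp
  finally show ?thesis .
qed simp

lemma t_norm_tendsto_one:
  assumes "g \<longlonglongrightarrow> 1" "h \<longlonglongrightarrow> 1" "\<And>n. g n \<in> {0..1}" "\<And>n. h n \<in> {0..1}"
  shows "(\<lambda>n. T (g n) (h n)) \<longlonglongrightarrow> 1"
proof -
  have "((\<lambda>n. (\<lambda>(\<mu>, \<nu>). T \<mu> \<nu>) (g n, h n)) \<longlongrightarrow> (\<lambda>(\<mu>, \<nu>). T \<mu> \<nu>) (1, 1)) sequentially"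
    using assms
    by (intro continuous_on_tendsto_compose[OF t_norm_continuous] tendsto_Pair) auto
  then show ?thesis using right_unit[of 1] by simp
qed

text \<open>Nearness \<open>1\<close> at a single scale already forces equality; the triangle inequality through
  \<open>x n\<close> gives it at scale \<open>1 + 1\<close>.\<close>

lemma limit_unique:
  assumes x: "\<And>n. x n \<in> X" and "a \<in> X" "b \<in> X"
    and "fuzzy_converges F x a" "fuzzy_converges F x b"
  shows "a = b"
proof -
  have lims: "(\<lambda>n. F (x n) a 1) \<longlonglongrightarrow> 1" "(\<lambda>n. F (x n) b 1) \<longlonglongrightarrow> 1"
    using assms by (auto simp: fuzzy_converges_iff_tendsto)
  have "(\<lambda>n. T (F (x n) a 1) (F (x n) b 1)) \<longlonglongrightarrow> 1"
    using range[OF x \<open>a \<in> X\<close>, of 1] range[OF x \<open>b \<in> X\<close>, of 1]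
    by (intro t_norm_tendsto_one lims) (auto simp: less_imp_le)
  moreover have "T (F (x n) a 1) (F (x n) b 1) \<le> F a b 2" for n
    using triangle[OF \<open>a \<in> X\<close> x \<open>b \<in> X\<close>, of 1 1 n] sym[OF \<open>a \<in> X\<close> x, of 1 n] by simp
  ultimately have "1 \<le> F a b 2"
    by (intro LIMSEQ_le_const2) auto
  then show ?thesis
    using range[of a b 2] eq_1_iff[of a b 2] \<open>a \<in> X\<close> \<open>b \<in> X\<close> by auto
qed

end

section \<open>Gauge functions\<close>

lemma gauge_iterate_pos:
  assumes "\<zeta> \<in> gauge_functions" "\<rho> > 0"
  shows "(\<zeta> ^^ n) \<rho> > 0"
proof (induction n)
  case (Suc n)
  then show ?case
    using funcset_mem[of \<zeta> "{0<..}" "{0<..}"] assms(1) by (simp add: gauge_functions_def)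
qed (use assms(2) in simp)

lemma gauge_iterates_tendsto_zero:
  assumes "\<zeta> \<in> gauge_functions" "\<rho> > 0"
  shows "(\<lambda>n. (\<zeta> ^^ n) \<rho>) \<longlonglongrightarrow> 0"
  using assms by (auto simp: gauge_functions_def)

text \<open>A gauge function may exceed the identity at many points, but it takes arbitrarily small
  values along the orbit of any point.\<close>

lemma gauge_small_value:
  assumes "\<zeta> \<in> gauge_functions" "t > 0"
  obtains \<rho> where "\<rho> > 0" "\<zeta> \<rho> > 0" "\<zeta> \<rho> < t"
proof -
  have "\<forall>\<^sub>F n in sequentially. (\<zeta> ^^ Suc n) 1 < t"
    using LIMSEQ_Suc[OF gauge_iterates_tendsto_zero[OF assms(1), of 1]] assms(2)
    by (intro order_tendstoD(2)) auto
  then obtain n where "(\<zeta> ^^ Suc n) 1 < t"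
    using eventually_happens' sequentially_bot by blast
  then show thesis
    using that[of "(\<zeta> ^^ n) 1"] gauge_iterate_pos[OF assms(1), of 1 n]
      gauge_iterate_pos[OF assms(1), of 1 "Suc n"]
    by simp
qed

section \<open>Orbits of a contraction\<close>

locale gauge_contraction = fuzzy_metric_space X F T
  for X :: "'a set" and F and T +
  fixes \<zeta> :: "real \<Rightarrow> real" and f :: "'a \<Rightarrow> 'a"
  assumes gauge: "\<zeta> \<in> gauge_functions"
    and contraction: "zeta_contraction X F \<zeta> f"
begin

lemma self_map: "u \<in> X \<Longrightarrow> f u \<in> X"
  using contraction by (auto simp: zeta_contraction_def)

lemma contraction_le: "u \<in> X \<Longrightarrow> v \<in> X \<Longrightarrow> \<rho> > 0 \<Longrightarrow> F u v \<rho> \<le> F (f u) (f v) (\<zeta> \<rho>)"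
  using contraction by (auto simp: zeta_contraction_def)

lemma iterate_in_carrier: "u \<in> X \<Longrightarrow> (f ^^ n) u \<in> X"
  by (induction n) (auto intro: self_map)

lemma iterated_contraction_le:
  assumes "u \<in> X" "v \<in> X" "\<rho> > 0"
  shows "F u v \<rho> \<le> F ((f ^^ n) u) ((f ^^ n) v) ((\<zeta> ^^ n) \<rho>)"
proof (induction n)
  case (Suc n)
  note Suc.IH
  also have "F ((f ^^ n) u) ((f ^^ n) v) ((\<zeta> ^^ n) \<rho>)
      \<le> F (f ((f ^^ n) u)) (f ((f ^^ n) v)) (\<zeta> ((\<zeta> ^^ n) \<rho>))"
    using assms by (intro contraction_le iterate_in_carrier gauge_iterate_pos[OF gauge])
  finally show ?case by simp
qed simp

text \<open>The order of choices matters: the starting scale \<open>\<rho>\<close> is fixed first, to make \<open>u\<close> and \<open>v\<close> near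
  at that scale, and only then is \<open>n\<close> taken large enough to shrink \<open>\<rho>\<close> below the target \<open>t\<close>.\<close>

lemma orbits_asymptotic:
  assumes "(F u v \<longlongrightarrow> 1) at_top" "u \<in> X" "v \<in> X" "t > 0"
  shows "(\<lambda>n. F ((f ^^ n) u) ((f ^^ n) v) t) \<longlonglongrightarrow> 1"
proof (rule order_tendstoI)
  fix a :: real assume "a < 1"
  then have "\<forall>\<^sub>F \<rho> in at_top. a < F u v \<rho>"
    by (rule order_tendstoD(1)[OF assms(1)])
  then have "\<forall>\<^sub>F \<rho> in at_top. a < F u v \<rho> \<and> \<rho> > 0"
    by (intro eventually_conj eventually_gt_at_top)
  then obtain \<rho> where \<rho>: "a < F u v \<rho>" "\<rho> > 0"
    by (auto simp: eventually_at_top_linorder)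
  have "\<forall>\<^sub>F n in sequentially. (\<zeta> ^^ n) \<rho> < t"
    using gauge_iterates_tendsto_zero[OF gauge \<rho>(2)] assms(4) by (rule order_tendstoD(2))
  then show "\<forall>\<^sub>F n in sequentially. a < F ((f ^^ n) u) ((f ^^ n) v) t"
  proof eventually_elim
    case (elim n)
    have "a < F ((f ^^ n) u) ((f ^^ n) v) ((\<zeta> ^^ n) \<rho>)"
      using \<rho>(1) iterated_contraction_le[OF assms(2,3) \<rho>(2)] by (rule less_le_trans)
    also have "\<dots> \<le> F ((f ^^ n) u) ((f ^^ n) v) t"
      using elim assms(2,3) \<rho>(2)
      by (intro fuzzy_metric_mono iterate_in_carrier gauge_iterate_pos[OF gauge]) auto
    finally show ?case .
  qed
next
  fix a :: real assume "1 < a"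
  then show "\<forall>\<^sub>F n in sequentially. F ((f ^^ n) u) ((f ^^ n) v) t < a"
    using range[OF iterate_in_carrier[OF assms(2)] iterate_in_carrier[OF assms(3)] assms(4)]
    by (intro always_eventually allI) (meson greaterThanAtMost_iff le_less_trans)
qed

text \<open>Continuity of \<open>f\<close>: closeness of images at scale \<open>t\<close> follows from closeness at some scale \<open>\<rho>\<close>
  with \<open>\<zeta> \<rho> < t\<close>, however large that \<open>\<rho>\<close> may be compared with \<open>t\<close>.\<close>

lemma contraction_converges:
  assumes x: "\<And>n. x n \<in> X" and "l \<in> X" "fuzzy_converges F x l"
  shows "fuzzy_converges F (\<lambda>n. f (x n)) (f l)"
  unfolding fuzzy_converges_iff_tendsto[OF self_map[OF x] self_map[OF \<open>l \<in> X\<close>]]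
proof (intro allI impI)
  fix t :: real assume t: "t > 0"
  obtain \<rho> where \<rho>: "\<rho> > 0" "\<zeta> \<rho> > 0" "\<zeta> \<rho> < t"
    using gauge_small_value[OF gauge t] .
  have le: "F (x n) l \<rho> \<le> F (f (x n)) (f l) t" for n
    using contraction_le[OF x \<open>l \<in> X\<close> \<rho>(1), of n]
      fuzzy_metric_mono[OF self_map[OF x] self_map[OF \<open>l \<in> X\<close>] \<rho>(2) less_imp_le[OF \<rho>(3)], of n]
    by linarith
  have le1: "F (f (x n)) (f l) t \<le> 1" for n
    using range[OF self_map[OF x] self_map[OF \<open>l \<in> X\<close>] t] by auto
  have lim: "(\<lambda>n. F (x n) l \<rho>) \<longlonglongrightarrow> 1"
    using assms \<rho>(1) by (simp add: fuzzy_converges_iff_tendsto)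
  show "(\<lambda>n. F (f (x n)) (f l) t) \<longlonglongrightarrow> 1"
    by (rule tendsto_sandwich[OF _ _ lim tendsto_const]) (simp_all add: le le1)
qed

lemma orbit_converges_to_fixed_point:
  assumes "(F u z \<longlongrightarrow> 1) at_top" "u \<in> X" "z \<in> X" "f z = z"
  shows "fuzzy_converges F (\<lambda>n. (f ^^ n) u) z"
proof -
  have "(f ^^ n) z = z" for n
    by (induction n) (auto simp: assms(4))
  then show ?thesis
    using orbits_asymptotic[OF assms(1-3)] assms(2,3)
    by (simp add: fuzzy_converges_iff_tendsto iterate_in_carrier)
qed

lemma orbit_G_Cauchy:
  assumes "\<And>v. v \<in> X \<Longrightarrow> (F u v \<longlongrightarrow> 1) at_top" "u \<in> X"
  shows "G_Cauchy F (\<lambda>n. (f ^^ n) u)"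
proof -
  have "(\<lambda>n. F ((f ^^ n) u) ((f ^^ (n + p)) u) \<rho>) \<longlonglongrightarrow> 1" if "\<rho> > 0" for p \<rho>
    using orbits_asymptotic[of u "(f ^^ p) u" \<rho>] assms that
    by (simp add: iterate_in_carrier funpow_add)
  then show ?thesis
    using assms(2) by (simp add: G_Cauchy_iff_tendsto iterate_in_carrier)
qed

lemma orbit_limit_fixed:
  assumes "u \<in> X" "z \<in> X" "fuzzy_converges F (\<lambda>n. (f ^^ n) u) z"
  shows "f z = z"
proof -
  let ?x = "\<lambda>n. (f ^^ Suc n) u"
  have "fuzzy_converges F ?x (f z)"
    using contraction_converges[OF iterate_in_carrier[OF assms(1)] assms(2,3)] by simp
  moreover have "fuzzy_converges F ?x z"
    unfolding fuzzy_converges_iff_tendsto[OF iterate_in_carrier[OF assms(1)] assms(2)]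
  proof (intro allI impI)
    fix \<rho> :: real assume "\<rho> > 0"
    then have "(\<lambda>n. F ((f ^^ n) u) z \<rho>) \<longlonglongrightarrow> 1"
      using assms by (simp add: fuzzy_converges_iff_tendsto iterate_in_carrier)
    then show "(\<lambda>n. F ((f ^^ Suc n) u) z \<rho>) \<longlonglongrightarrow> 1"
      by (rule LIMSEQ_Suc)
  qed
  ultimately show ?thesis
    by (rule limit_unique[OF iterate_in_carrier[OF assms(1)] self_map[OF assms(2)] assms(2)])
qed

end

section \<open>The fixed point theorem\<close>

theorem theorem16:
  fixes \<Xi> :: "'a set"
    and \<Theta> :: "'a \<Rightarrow> 'a \<Rightarrow> real \<Rightarrow> real"
    and \<Gamma> :: "real \<Rightarrow> real \<Rightarrow> real"
    and \<zeta> :: "real \<Rightarrow> real"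
    and f :: "'a \<Rightarrow> 'a"
  assumes "fuzzy_metric_space \<Xi> \<Theta> \<Gamma>"
    and "G_complete \<Xi> \<Theta>"
    and "H_type \<Gamma>"
    and "\<And>u v. u \<in> \<Xi> \<Longrightarrow> v \<in> \<Xi> \<Longrightarrow> (\<Theta> u v \<longlongrightarrow> 1) at_top"
    and "\<zeta> \<in> gauge_functions"
    and "zeta_contraction \<Xi> \<Theta> \<zeta> f"
  shows "\<exists>z\<in>\<Xi>. f z = z \<and> (\<forall>w\<in>\<Xi>. f w = w \<longrightarrow> w = z) \<and>
           (\<forall>u\<in>\<Xi>. fuzzy_converges \<Theta> (\<lambda>n. (f ^^ n) u) z)"
proof -
  interpret gauge_contraction \<Xi> \<Theta> \<Gamma> \<zeta> f
    using assms by (simp add: gauge_contraction_def gauge_contraction_axioms_def)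
  obtain u where u: "u \<in> \<Xi>" using nonempty by blast
  obtain z where z: "z \<in> \<Xi>" "fuzzy_converges \<Theta> (\<lambda>n. (f ^^ n) u) z"
    using assms(2)[unfolded G_complete_def, rule_format, of "\<lambda>n. (f ^^ n) u",
        OF iterate_in_carrier[OF u] orbit_G_Cauchy[OF assms(4)[OF u] u]] by blast
  have fixed: "f z = z" using orbit_limit_fixed[OF u z] .
  have conv: "fuzzy_converges \<Theta> (\<lambda>n. (f ^^ n) v) z" if "v \<in> \<Xi>" for v
    using orbit_converges_to_fixed_point[OF assms(4)[OF that z(1)] that z(1) fixed] .
  have "w = z" if w: "w \<in> \<Xi>" "f w = w" for w
  proof (rule limit_unique[OF iterate_in_carrier[OF w(1)] w(1) z(1) _ conv[OF w(1)]])
    show "fuzzy_converges \<Theta> (\<lambda>n. (f ^^ n) w) w"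
      using orbit_converges_to_fixed_point[OF assms(4)[OF w(1) w(1)] w(1) w(1) w(2)] .
  qed
  then show ?thesis using z(1) fixed conv by blast
qed

end
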